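(* Let $f:\mathbb{F}_2^n\to\mathbb{F}_2^n$ be a Boolean monomial system whose dependency graph $\mathcal{X}$ is strongly connected with loop number $t\ge 1$. Then the subgraph of cycles in the state space of $f$ (the vertices lying on directed cycles, together with the edges of those cycles) is isomorphic, as a digraph, to the state space of the system of a directed $t$-gon, i.e. of $(y_1,\ldots,y_t)\mapsto(y_2,\ldots,y_t,y_1)$ on $\mathbb{F}_2^t$. Hence the limit cycles of $f$ correspond to the orbits of the hypercube $\mathbb{F}_2^t$ under the action of the cyclic group $C_t$ by cyclic permutation of the canonical basis vectors, the length of a limit cycle being the size of the corresponding orbit.
   Context: A Boolean monomial system is a map $f=(f_1,\ldots,f_n):\mathbb{F}_2^n\to\mathbb{F}_2^n$ where each $f_i=\alpha_i x_1^{\varepsilon_{1i}}\cdots x_n^{\varepsilon_{ni}}$ with $\alpha_i,\varepsilon_{ji}\in\{0,1\}$ (all $\varepsilon_{ji}=0$ if $\alpha_i=0$); so each $f_i$ is $0$, $1$, or a product of distinct variables. The state space of $f$ is the digraph on $\mathbb{F}_2^n$ with an edge $u\to v$ iff $f(u)=v$ (self-edges allowed); its directed cycles are called limit cycles. The dependency graph $\mathcal{X}$ of $f$ is the digraph with vertex set $\{a_1,\ldots,a_n,\varepsilon\}$, with an edge $a_i\to a_j$ iff $\alpha_i=1$ and $\varepsilon_{ji}=1$, and an edge $a_i\to\varepsilon$ iff $f_i=0$. Write $a\in\mathcal{X}$ for a vertex $a\ne\varepsilon$. A walk is a directed walk (repetitions allowed), $|p|$ is its length, and the empty walk has length $0$.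 $\mathcal{X}$ is strongly connected if for all $a,b\in\mathcal{X}$ there is a walk from $a$ to $b$. The loop number of $a\in\mathcal{X}$ is the minimum of all $t\ge 1$ such that $t=|p|-|q|$ for closed walks $p,q:a\to a$; it is $0$ if there is no closed walk of positive length at $a$. On a strongly connected $\mathcal{X}$ it is the same for all vertices and is called the loop number of $\mathcal{X}$. *)

theory Defs
  imports
    "HOL-Library.Z2"
    "HOL-Library.FuncSet"
    "HOL-Algebra.Group_Action"
    "HOL-Algebra.Elementary_Groups"
    "Graph_Theory.Digraph_Isomorphism"
begin

text \<open>Coordinates are indexed by \<open>0, \<dots>, n - 1\<close> throughout.\<close>

definition cube :: "nat \<Rightarrow> (nat \<Rightarrow> bit) set" where
  "cube n = {..<n} \<rightarrow>\<^sub>E (UNIV :: bit set)"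


subsection \<open>Boolean monomial systems\<close>

text \<open>
  A system is given by its coefficients and exponents; \<open>e j i\<close> is the exponent of the
  variable \<open>x\<^sub>j\<close> in the monomial \<open>f\<^sub>i\<close>.
\<close>

definition boolean_monomial_system :: "nat \<Rightarrow> (nat \<Rightarrow> bit) \<Rightarrow> (nat \<Rightarrow> nat \<Rightarrow> nat) \<Rightarrow> bool" where
  "boolean_monomial_system n \<alpha> e \<longleftrightarrow>
     (\<forall>i<n. \<forall>j<n. e j i \<in> {0, 1}) \<and>
     (\<forall>i<n. \<alpha> i = 0 \<longrightarrow> (\<forall>j<n. e j i = 0))"

definition monomial_map ::
  "nat \<Rightarrow> (nat \<Rightarrow> bit) \<Rightarrow> (nat \<Rightarrow> nat \<Rightarrow> nat) \<Rightarrow> (nat \<Rightarrow> bit) \<Rightarrow> (nat \<Rightarrow> bit)" where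
  "monomial_map n \<alpha> e x = (\<lambda>i\<in>{..<n}. \<alpha> i * (\<Prod>j<n. x j ^ e j i))"

definition state_space ::
  "nat \<Rightarrow> ((nat \<Rightarrow> bit) \<Rightarrow> (nat \<Rightarrow> bit)) \<Rightarrow> (nat \<Rightarrow> bit, (nat \<Rightarrow> bit) \<times> (nat \<Rightarrow> bit)) pre_digraph" where
  "state_space n f =
     \<lparr>verts = cube n, arcs = {(u, v). u \<in> cube n \<and> v \<in> cube n \<and> f u = v}, tail = fst, head = snd\<rparr>"


subsection \<open>Dependency graphs\<close>

datatype dep_vertex = Var nat | Eps

definition dependency_graph ::
  "nat \<Rightarrow> (nat \<Rightarrow> bit) \<Rightarrow> (nat \<Rightarrow> nat \<Rightarrow> nat) \<Rightarrow> (dep_vertex, dep_vertex \<times> dep_vertex) pre_digraph" where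
  "dependency_graph n \<alpha> e =
     \<lparr>verts = insert Eps (Var ` {..<n}),
      arcs = {(Var i, Var j) | i j. i < n \<and> j < n \<and> \<alpha> i = 1 \<and> e j i = 1}
             \<union> {(Var i, Eps) | i. i < n \<and> (\<forall>x\<in>cube n. monomial_map n \<alpha> e x i = 0)},
      tail = fst, head = snd\<rparr>"

text \<open>
  The vertex \<open>Eps\<close> is exempt from the connectivity condition, so this is not
  \<open>strongly_connected\<close> of the digraph library.
\<close>

definition dep_strongly_connected :: "(dep_vertex, 'b) pre_digraph \<Rightarrow> bool" where
  "dep_strongly_connected X \<longleftrightarrow>
     (\<forall>a \<in> verts X - {Eps}. \<forall>b \<in> verts X - {Eps}. \<exists>p. pre_digraph.awalk X a p b)"

definition vertex_loop_number :: "('a, 'b) pre_digraph \<Rightarrow> 'a \<Rightarrow> nat" where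
  "vertex_loop_number X a =
     (if \<exists>p. pre_digraph.awalk X a p a \<and> 0 < length p
      then LEAST t. 1 \<le> t \<and> (\<exists>p q. pre_digraph.awalk X a p a \<and> pre_digraph.awalk X a q a
                                 \<and> int t = int (length p) - int (length q))
      else 0)"

text \<open>
  Meaningful only if the value is common to all vertices other than \<open>Eps\<close> and there is
  at least one such vertex.
\<close>

definition loop_number :: "(dep_vertex, 'b) pre_digraph \<Rightarrow> nat" where
  "loop_number X = (THE t. \<forall>a \<in> verts X - {Eps}. vertex_loop_number X a = t)"


subsection \<open>Limit cycles\<close>

text \<open>
  An arc list \<open>p\<close> with \<open>pre_digraph.cycle G p\<close> has a distinguished starting point. The
  directed cycle as a subgraph, independent of this choice, is \<open>cycle_graph G p\<close>.
\<close>

definition cycle_graph :: "('a, 'b) pre_digraph \<Rightarrow> 'b list \<Rightarrow> ('a, 'b) pre_digraph" where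
  "cycle_graph G p = \<lparr>verts = tail G ` set p, arcs = set p, tail = tail G, head = head G\<rparr>"

definition limit_cycles :: "('a, 'b) pre_digraph \<Rightarrow> ('a, 'b) pre_digraph set" where
  "limit_cycles G = {cycle_graph G p | p. pre_digraph.cycle G p}"

definition cycles_subgraph :: "('a, 'b) pre_digraph \<Rightarrow> ('a, 'b) pre_digraph" where
  "cycles_subgraph G =
     \<lparr>verts = \<Union> (verts ` limit_cycles G), arcs = \<Union> (arcs ` limit_cycles G),
      tail = tail G, head = head G\<rparr>"


subsection \<open>The directed polygon and the cyclic action on the hypercube\<close>

definition tgon_map :: "nat \<Rightarrow> (nat \<Rightarrow> bit) \<Rightarrow> (nat \<Rightarrow> bit)" where
  "tgon_map t y = (\<lambda>i\<in>{..<t}. y (Suc i mod t))"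

lemma tgon_map_monomial:
  assumes "y \<in> cube t"
  shows "tgon_map t y = monomial_map t (\<lambda>_. 1) (\<lambda>j i. of_bool (j = Suc i mod t)) y"
proof
  fix i
  show "tgon_map t y i = monomial_map t (\<lambda>_. 1) (\<lambda>j i. of_bool (j = Suc i mod t)) y i"
  proof (cases "i < t")
    case True
    then have "Suc i mod t < t" by simp
    have "(\<Prod>j<t. y j ^ of_bool (j = Suc i mod t)) = (\<Prod>j<t. if j = Suc i mod t then y j else 1)"
      by (rule prod.cong) auto
    also have "\<dots> = y (Suc i mod t)"
      using \<open>Suc i mod t < t\<close> by (simp add: prod.delta)
    finally show ?thesis using True by (simp add: tgon_map_def monomial_map_def)
  qed (simp add: tgon_map_def monomial_map_def)
qed

definition basis_vector :: "nat \<Rightarrow> nat \<Rightarrow> (nat \<Rightarrow> bit)" where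
  "basis_vector t i = (\<lambda>l\<in>{..<t}. of_bool (l = i))"

text \<open>
  The element \<open>k\<close> of the cyclic group \<open>integer_mod_group t\<close> acts linearly by
  \<open>b\<^sub>j \<mapsto> b\<^bsub>j + k mod t\<^esub>\<close> on the canonical basis, where
  \<open>b\<^sub>j = basis_vector t j\<close>.
\<close>

definition cyclic_action :: "nat \<Rightarrow> int \<Rightarrow> (nat \<Rightarrow> bit) \<Rightarrow> (nat \<Rightarrow> bit)" where
  "cyclic_action t k =
     (\<lambda>x\<in>cube t. \<lambda>l\<in>{..<t}. \<Sum>j<t. x j * basis_vector t (nat ((int j + k) mod int t)) l)"

lemma cyclic_action_apply:
  assumes "x \<in> cube t" "l < t"
  shows "cyclic_action t k x l = x (nat ((int l - k) mod int t))"
proof -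
  let ?m = "nat ((int l - k) mod int t)"
  have m: "?m < t" using assms(2) by (simp add: nat_less_iff)
  have eq: "l = nat ((int j + k) mod int t) \<longleftrightarrow> j = ?m" if "j < t" for j
  proof
    assume "l = nat ((int j + k) mod int t)"
    then have "int l = (int j + k) mod int t" using assms(2) by simp
    then have "(int l - k) mod int t = int j mod int t" by (simp add: mod_diff_left_eq)
    then show "j = ?m" using that by simp
  next
    assume "j = ?m"
    then have "int j = (int l - k) mod int t" using assms(2) by simp
    then have "(int j + k) mod int t = int l mod int t" by (simp add: mod_add_left_eq)
    then show "l = nat ((int j + k) mod int t)" using assms(2) by simp
  qed
  have "cyclic_action t k x l
          = (\<Sum>j<t. x j * basis_vector t (nat ((int j + k) mod int t)) l)"
    using assms by (simp only: cyclic_action_def restrict_apply lessThan_iff if_True)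
  also have "\<dots> = (\<Sum>j<t. if j = ?m then x j else 0)"
  proof (rule sum.cong)
    fix j assume "j \<in> {..<t}"
    then have "basis_vector t (nat ((int j + k) mod int t)) l = of_bool (j = ?m)"
      using eq[of j] assms(2) by (simp add: basis_vector_def)
    then show "x j * basis_vector t (nat ((int j + k) mod int t)) l = (if j = ?m then x j else 0)"
      by (cases "j = ?m") auto
  qed simp
  also have "\<dots> = x ?m" using m by (subst sum.delta) auto
  finally show ?thesis .
qed

lemma cyclic_action_closed: "x \<in> cube t \<Longrightarrow> cyclic_action t k x \<in> cube t"
  by (auto simp: cyclic_action_def cube_def)

lemma cyclic_action_add:
  assumes x: "x \<in> cube t"
  shows "cyclic_action t g (cyclic_action t h x) = cyclic_action t ((g + h) mod int t) x"
    (is "?L = ?R")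
proof
  fix l
  show "?L l = ?R l"
  proof (cases "l < t")
    case True
    let ?m = "nat ((int l - g) mod int t)"
    have "?m < t" using True by (simp add: nat_less_iff)
    moreover have "((int l - g) mod int t - h) mod int t = (int l - (g + h) mod int t) mod int t"
      by (simp add: mod_diff_left_eq mod_diff_right_eq algebra_simps)
    ultimately show ?thesis
      using True x by (simp add: cyclic_action_apply cyclic_action_closed)
  next
    case False
    then show ?thesis
      using cyclic_action_closed[OF cyclic_action_closed[OF x]] cyclic_action_closed[OF x]
      by (auto simp: cube_def PiE_def extensional_def)
  qed
qed

lemma cyclic_action_0:
  assumes x: "x \<in> cube t"
  shows "cyclic_action t 0 x = x"
proof
  fix l
  show "cyclic_action t 0 x l = x l"
  proof (cases "l < t")
    case True
    then show ?thesis using x by (simp add: cyclic_action_apply)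
  next
    case False
    then show ?thesis
      using cyclic_action_closed[OF x, of 0] x by (auto simp: cube_def PiE_def extensional_def)
  qed
qed

lemma group_action_cyclic_action:
  assumes "1 \<le> t"
  shows "group_action (integer_mod_group t) (cube t) (cyclic_action t)"
proof -
  have bij: "cyclic_action t g \<in> Bij (cube t)" for g
  proof -
    have "bij_betw (cyclic_action t g) (cube t) (cube t)"
      by (rule bij_betw_byWitness[where f' = "cyclic_action t (- g)"])
         (auto simp: cyclic_action_add cyclic_action_0 cyclic_action_closed)
    then show ?thesis by (simp add: Bij_def cyclic_action_def)
  qed
  have "cyclic_action t ((g + h) mod int t)
          = compose (cube t) (cyclic_action t g) (cyclic_action t h)" for g h
    by (rule extensionalityI[of _ "cube t"])
       (auto simp: compose_eq cyclic_action_add, auto simp: cyclic_action_def)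
  then have "cyclic_action t \<in> hom (integer_mod_group t) (BijGroup (cube t))"
    using bij by (auto simp: hom_def BijGroup_def)
  then show ?thesis
    by (simp add: group_action_def group_hom_def group_hom_axioms_def group_BijGroup)
qed

end

theory Submission
  imports Defs
begin

text \<open>
  If \<open>x\<close> is a state then \<open>(f\<^sup>k x)\<^sub>i = 1\<close> iff \<open>x\<^sub>j = 1\<close> for every \<open>j\<close> that is reachable
  from \<open>i\<close> by a walk of length \<open>k\<close> in the dependency graph. The vertices of a strongly connected
  graph with loop number \<open>t\<close> fall into classes \<open>c i\<close> modulo \<open>t\<close> such that edges raise the class
  by one and, for all large \<open>k\<close>, walks of length \<open>k\<close> from \<open>i\<close> to \<open>j\<close> exist iff
  \<open>c i + k \<equiv> c j\<close> modulo \<open>t\<close>. Hence a periodic state is constant on the classes, and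
  \<open>y \<mapsto> y \<circ> c\<close> is an equivariant bijection from the hypercube of dimension \<open>t\<close>, on which the
  system of the \<open>t\<close>-gon acts by rotation, to the periodic states of \<open>f\<close>.
\<close>

section \<open>Loop numbers of relations\<close>

text \<open>Copies \<open>vertex_loop_number\<close> with each walk replaced by its length: a walk
  of length \<open>k\<close> from \<open>a\<close> to \<open>b\<close> exists iff
  \<open>(a, b) \<in> R ^^ k\<close>, so the arithmetic below needs no arc lists.\<close>

definition rel_loop_number :: "('a \<times> 'a) set \<Rightarrow> 'a \<Rightarrow> nat" where
  "rel_loop_number R a =
     (if \<exists>k>0. (a, a) \<in> R ^^ k
      then LEAST t. 1 \<le> t \<and> (\<exists>k l. (a, a) \<in> R ^^ k \<and> (a, a) \<in> R ^^ l \<and> int t = int k - int l)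
      else 0)"

lemma relpow_addI: "(a, b) \<in> R ^^ k \<Longrightarrow> (b, c) \<in> R ^^ l \<Longrightarrow> (a, c) \<in> R ^^ (k + l)"
  by (auto simp: relpow_add)

lemma closed_walk_power: "(a, a) \<in> R ^^ k \<Longrightarrow> (a, a) \<in> R ^^ (m * k)"
  by (induction m) (auto intro: relpow_addI)

text \<open>Inserting a closed walk at \<open>b\<close> into a fixed round trip from
  \<open>a\<close> through \<open>b\<close> adds the same amount to every length, so differences of
  lengths are preserved.\<close>

lemma rel_loop_number_eq:
  assumes "(a, b) \<in> R\<^sup>*" "(b, a) \<in> R\<^sup>*"
  shows "rel_loop_number R a = rel_loop_number R b"
proof -
  have walk: "\<exists>d. \<forall>k. (y, y) \<in> R ^^ k \<longrightarrow> (x, x) \<in> R ^^ (k + d)"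
    if xy: "(x, y) \<in> R\<^sup>*" and yx: "(y, x) \<in> R\<^sup>*" for x y
  proof -
    obtain r where r: "(x, y) \<in> R ^^ r" using xy rtrancl_imp_relpow by blast
    obtain s where s: "(y, x) \<in> R ^^ s" using yx rtrancl_imp_relpow by blast
    have "(x, x) \<in> R ^^ (k + (r + s))" if "(y, y) \<in> R ^^ k" for k
      using relpow_addI[OF relpow_addI[OF r that] s] by (simp add: algebra_simps)
    then show ?thesis by blast
  qed
  have pos: "\<exists>k>0. (x, x) \<in> R ^^ k"
    if "(x, y) \<in> R\<^sup>*" "(y, x) \<in> R\<^sup>*" "\<exists>k>0. (y, y) \<in> R ^^ k" for x y
    using walk[OF that(1,2)] that(3) by (metis add_gr_0)
  have diff: "\<exists>k l. (x, x) \<in> R ^^ k \<and> (x, x) \<in> R ^^ l \<and> int t = int k - int l"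
    if xy: "(x, y) \<in> R\<^sup>*" "(y, x) \<in> R\<^sup>*"
      and t: "\<exists>k l. (y, y) \<in> R ^^ k \<and> (y, y) \<in> R ^^ l \<and> int t = int k - int l" for x y t
  proof -
    obtain d where d: "\<forall>k. (y, y) \<in> R ^^ k \<longrightarrow> (x, x) \<in> R ^^ (k + d)"
      using walk[OF xy] by blast
    obtain k l where "(y, y) \<in> R ^^ k" "(y, y) \<in> R ^^ l" "int t = int k - int l"
      using t by blast
    then have "(x, x) \<in> R ^^ (k + d)" "(x, x) \<in> R ^^ (l + d)" "int t = int (k + d) - int (l + d)"
      using d by auto
    then show ?thesis by blast
  qed
  have "(\<exists>k>0. (a, a) \<in> R ^^ k) = (\<exists>k>0. (b, b) \<in> R ^^ k)"
    using pos assms by blast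
  moreover have "(\<exists>k l. (a, a) \<in> R ^^ k \<and> (a, a) \<in> R ^^ l \<and> int t = int k - int l) =
      (\<exists>k l. (b, b) \<in> R ^^ k \<and> (b, b) \<in> R ^^ l \<and> int t = int k - int l)" for t
    using diff[of a b t] diff[of b a t] assms by blast
  ultimately show ?thesis by (simp only: rel_loop_number_def)
qed

lemma rel_loop_number_witness:
  assumes "1 \<le> rel_loop_number R a"
  obtains k l where "(a, a) \<in> R ^^ k" "(a, a) \<in> R ^^ l" "k = l + rel_loop_number R a"
proof -
  define P where "P t \<longleftrightarrow> 1 \<le> t \<and> (\<exists>k l. (a, a) \<in> R ^^ k \<and> (a, a) \<in> R ^^ l \<and> int t = int k - int l)"
    for t :: nat
  obtain k where k: "0 < k" "(a, a) \<in> R ^^ k"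
    using assms by (auto simp: rel_loop_number_def split: if_splits)
  \<comment> \<open>The empty walk as second walk makes \<open>k\<close> itself a candidate for the
    minimum.\<close>
  moreover have "(a, a) \<in> R ^^ 0" by simp
  ultimately have "P k" unfolding P_def
    by (metis Suc_leI One_nat_def diff_zero of_nat_0)
  then have "P (Least P)" by (rule LeastI)
  moreover have "rel_loop_number R a = Least P"
    unfolding rel_loop_number_def P_def using k by meson
  ultimately obtain k l where "(a, a) \<in> R ^^ k" "(a, a) \<in> R ^^ l"
    "int (rel_loop_number R a) = int k - int l"
    unfolding P_def by auto
  then show thesis by (intro that[of k l]) auto
qed

lemma rel_loop_number_le:
  assumes "(a, a) \<in> R ^^ k" "(a, a) \<in> R ^^ l" "l < k"
  shows "rel_loop_number R a \<le> k - l"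
proof -
  have "1 \<le> k - l \<and> (\<exists>k' l'. (a, a) \<in> R ^^ k' \<and> (a, a) \<in> R ^^ l' \<and> int (k - l) = int k' - int l')"
    using assms by (metis One_nat_def Suc_leI int_ops(6) less_imp_le not_less of_nat_le_iff zero_less_diff)
  then show ?thesis
    unfolding rel_loop_number_def by (auto intro: Least_le)
qed

text \<open>A nonzero remainder of \<open>k\<close> would be a difference of closed walk lengths
  below the minimum: with loop number \<open>p - q\<close> and \<open>m\<close> the quotient, the
  remainder is \<open>(k + m * q) - m * p\<close>.\<close>

lemma rel_loop_number_dvd:
  assumes t: "1 \<le> rel_loop_number R a" and k: "(a, a) \<in> R ^^ k"
  shows "rel_loop_number R a dvd k"
proof (rule ccontr)
  let ?t = "rel_loop_number R a"
  assume "\<not> ?t dvd k"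
  then have r: "0 < k mod ?t" by (simp add: dvd_eq_mod_eq_0)
  obtain p q where p: "(a, a) \<in> R ^^ p" and q: "(a, a) \<in> R ^^ q" and pq: "p = q + ?t"
    using t by (rule rel_loop_number_witness)
  let ?m = "k div ?t"
  have 1: "(a, a) \<in> R ^^ (k + ?m * q)" using k q by (blast intro: relpow_addI closed_walk_power)
  have 2: "(a, a) \<in> R ^^ (?m * p)" using p by (rule closed_walk_power)
  have eq: "k + ?m * q = ?m * p + k mod ?t"
    unfolding pq by (simp add: algebra_simps)
  have "?t \<le> (k + ?m * q) - ?m * p"
    by (rule rel_loop_number_le[OF 1 2]) (use r eq in linarith)
  then have "?t \<le> k mod ?t" using eq by simp
  then show False using t by (metis Suc_le_eq One_nat_def mod_less_divisor not_le)
qed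

text \<open>
  With closed walks of lengths \<open>q = t m\<close> and \<open>q + t\<close>, a multiple \<open>t (d m + r)\<close> of \<open>t\<close> where
  \<open>r < m \<le> d\<close> is \<open>(d - r) q + r (q + t)\<close>.
\<close>
lemma closed_walk_large:
  assumes t: "1 \<le> rel_loop_number R a"
  obtains K where "\<And>k. K \<le> k \<Longrightarrow> rel_loop_number R a dvd k \<Longrightarrow> (a, a) \<in> R ^^ k"
proof -
  let ?t = "rel_loop_number R a"
  obtain p q where p: "(a, a) \<in> R ^^ p" and q: "(a, a) \<in> R ^^ q" and pq: "p = q + ?t"
    using t by (rule rel_loop_number_witness)
  obtain m where m: "q = ?t * m" using rel_loop_number_dvd[OF t q] by blast
  show thesis
  proof (rule that[of "?t * (m * m)"])
    fix k assume k: "?t * (m * m) \<le> k" "?t dvd k"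
    then obtain k' where k': "k = ?t * k'" by blast
    then have mk: "m * m \<le> k'" using k t by simp
    show "(a, a) \<in> R ^^ k"
    proof (cases "m = 0")
      \<comment> \<open>Here \<open>q = 0\<close>, so \<open>p\<close> is the loop number and
        repeating that one walk reaches every multiple.\<close>
      case True
      then have "k = k' * p" using m pq k' by simp
      then show ?thesis using closed_walk_power[OF p] by simp
    next
      case False
      let ?r = "k' mod m" and ?d = "k' div m"
      have "m \<le> ?d" using mk False
        by (metis div_le_mono nonzero_mult_div_cancel_right)
      moreover have "?r < m" using False by simp
      ultimately obtain s where s: "?d = s + ?r" by (metis le_add_diff_inverse2 less_or_eq_imp_le order_trans)
      have "k' = ?d * m + ?r" by simp
      then have "k = ?t * (?d * m + ?r)" using k' by simp
      also have "\<dots> = s * q + ?r * p" unfolding s pq m by (simp add: algebra_simps)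
      finally show ?thesis
        using relpow_addI[OF closed_walk_power[OF q] closed_walk_power[OF p]] by simp
    qed
  qed
qed

section \<open>Cyclic classes of a strongly connected relation\<close>

text \<open>The class of \<open>i\<close> is the length modulo \<open>t\<close> of any walk from
  \<open>v\<close> to \<open>i\<close>. It is well defined because two such walks, completed by the
  same walk back, become closed walks at \<open>v\<close>, whose lengths \<open>t\<close>
  divides.\<close>

lemma cyclic_classes:
  assumes fin: "finite V" and v: "v \<in> V" and R: "R \<subseteq> V \<times> V"
    and strong: "\<And>a b. a \<in> V \<Longrightarrow> b \<in> V \<Longrightarrow> (a, b) \<in> R\<^sup>*"
    and total: "\<And>a. a \<in> V \<Longrightarrow> \<exists>b. (a, b) \<in> R"
    and t: "rel_loop_number R v = t" "1 \<le> t"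
  obtains c K where "c ` V = {..<t}"
    and "\<And>i j. (i, j) \<in> R \<Longrightarrow> c j = Suc (c i) mod t"
    and "\<And>i j k. i \<in> V \<Longrightarrow> j \<in> V \<Longrightarrow> K \<le> k \<Longrightarrow> (c i + k) mod t = c j \<Longrightarrow> (i, j) \<in> R ^^ k"
proof -
  have "\<exists>k. (v, i) \<in> R ^^ k" if "i \<in> V" for i
    using strong[OF v that] rtrancl_imp_relpow by blast
  then obtain d where d: "\<And>i. i \<in> V \<Longrightarrow> (v, i) \<in> R ^^ d i" by metis
  have "\<exists>k. (i, v) \<in> R ^^ k" if "i \<in> V" for i
    using strong[OF that v] rtrancl_imp_relpow by blast
  then obtain s where s: "\<And>i. i \<in> V \<Longrightarrow> (i, v) \<in> R ^^ s i" by metis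
  have dvd: "t dvd k" if "(v, v) \<in> R ^^ k" for k
    using rel_loop_number_dvd[of R v k] t that by simp
  obtain K where K: "\<And>k. K \<le> k \<Longrightarrow> t dvd k \<Longrightarrow> (v, v) \<in> R ^^ k"
    using closed_walk_large[of R v] t by metis
  define c where "c i = d i mod t" for i
  have walk: "k mod t = c j" if "j \<in> V" "(v, j) \<in> R ^^ k" for j k
  proof -
    have "t dvd k + s j" "t dvd d j + s j"
      using that d s by (blast intro: dvd relpow_addI)+
    then have "(int k + int (s j)) mod int t = (int (d j) + int (s j)) mod int t"
      by (metis dvd_imp_mod_0 of_nat_0 of_nat_add of_nat_mod)
    then have "int t dvd int k - int (d j)" by (simp add: mod_eq_dvd_iff)
    then have "int k mod int t = int (d j) mod int t" by (simp add: mod_eq_dvd_iff)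
    then show ?thesis unfolding c_def by (metis of_nat_eq_iff of_nat_mod)
  qed
  have edge: "c j = Suc (c i) mod t" if "(i, j) \<in> R" for i j
  proof -
    have "i \<in> V" "j \<in> V" using that R by auto
    then have "(v, j) \<in> R ^^ Suc (d i)" using d that by (auto intro: relpow_Suc_I)
    then have "Suc (d i) mod t = c j" using walk \<open>j \<in> V\<close> by blast
    then show ?thesis by (simp add: c_def mod_Suc_eq)
  qed
  \<comment> \<open>This makes \<open>c\<close> surjective: a walk of length \<open>l < t\<close>
    from \<open>v\<close> ends in class \<open>l\<close>.\<close>
  have long: "\<exists>j\<in>V. (v, j) \<in> R ^^ k" for k
  proof (induction k)
    case (Suc k)
    then obtain j where "j \<in> V" "(v, j) \<in> R ^^ k" by blast
    moreover then obtain j' where "(j, j') \<in> R" using total by blast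
    ultimately show ?case using R by (blast intro: relpow_Suc_I)
  qed (use v in auto)
  have "c ` V = {..<t}"
  proof
    show "c ` V \<subseteq> {..<t}" using t by (auto simp: c_def)
    show "{..<t} \<subseteq> c ` V"
    proof
      fix l assume "l \<in> {..<t}"
      moreover obtain j where "j \<in> V" "(v, j) \<in> R ^^ l" using long by blast
      ultimately show "l \<in> c ` V" using walk[of j l] by (auto intro: image_eqI[of _ _ j])
    qed
  qed
  moreover
  \<comment> \<open>A long walk from \<open>i\<close> to \<open>j\<close> is routed through
    \<open>v\<close>. After the legs of lengths \<open>s i\<close> and \<open>d j\<close>, this
    bound leaves at least \<open>K\<close> for a closed walk at \<open>v\<close>, whose length
    \<open>r\<close> is then shown to be a multiple of \<open>t\<close>.\<close>
  define M where "M = K + Max (s ` V) + Max (d ` V)"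
  have "(i, j) \<in> R ^^ k" if ij: "i \<in> V" "j \<in> V" and k: "M \<le> k" "(c i + k) mod t = c j" for i j k
  proof -
    have "s i \<le> Max (s ` V)" "d j \<le> Max (d ` V)" using ij fin by auto
    then obtain r where r: "k = s i + r + d j" "K \<le> r"
      using k unfolding M_def by (intro that[of "k - s i - d j"]) auto
    have "t dvd d i + s i" using ij d s by (blast intro: dvd relpow_addI)
    moreover have "(d i + k) mod t = d j mod t" using k by (simp add: c_def mod_add_left_eq)
    then have "(d i + s i + r + d j) mod t = d j mod t" unfolding r by (simp add: algebra_simps)
    then have "int t dvd int (d i + s i + r)"
      by (metis add_diff_cancel_right' mod_eq_dvd_iff of_nat_add of_nat_mod)
    then have "t dvd d i + s i + r" by presburger
    ultimately have "t dvd r" using dvd_add_right_iff by blast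
    then have "(v, v) \<in> R ^^ r" using K r by blast
    then show ?thesis unfolding r using ij d s by (blast intro: relpow_addI)
  qed
  ultimately show thesis using edge by (intro that[of c M]) auto
qed

section \<open>Walks in the dependency graph\<close>

definition dep_rel :: "nat \<Rightarrow> (nat \<Rightarrow> bit) \<Rightarrow> (nat \<Rightarrow> nat \<Rightarrow> nat) \<Rightarrow> (nat \<times> nat) set" where
  "dep_rel n \<alpha> e = {(i, j). i < n \<and> j < n \<and> \<alpha> i = 1 \<and> e j i = 1}"

text \<open>No arc leaves \<open>Eps\<close>, so a walk that ends in some \<open>Var j\<close> never
  visits it.\<close>

lemma awalk_dep_rel:
  assumes "pre_digraph.awalk (dependency_graph n \<alpha> e) (Var i) p (Var j)"
  shows "(i, j) \<in> dep_rel n \<alpha> e ^^ length p"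
  using assms
proof (induction p arbitrary: i)
  case Nil
  then show ?case by (simp add: pre_digraph.awalk_def pre_digraph.cas.simps)
next
  case (Cons a p)
  have a: "a \<in> arcs (dependency_graph n \<alpha> e)" "fst a = Var i"
    and p: "set p \<subseteq> arcs (dependency_graph n \<alpha> e)"
      "pre_digraph.cas (dependency_graph n \<alpha> e) (snd a) p (Var j)"
    using Cons.prems
    by (auto simp: pre_digraph.awalk_def pre_digraph.cas.simps dependency_graph_def)
  have "snd a \<noteq> Eps"
  proof
    assume eps: "snd a = Eps"
    show False
    proof (cases p)
      case Nil
      then show ?thesis using p eps by (simp add: pre_digraph.cas.simps)
    next
      case (Cons b q)
      then show ?thesis using p eps
        by (auto simp: pre_digraph.cas.simps dependency_graph_def)
    qed
  qed
  then obtain k where k: "a = (Var i, Var k)" "(i, k) \<in> dep_rel n \<alpha> e"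
    using a by (auto simp: dependency_graph_def dep_rel_def)
  then have "pre_digraph.awalk (dependency_graph n \<alpha> e) (Var k) p (Var j)"
    using p by (auto simp: pre_digraph.awalk_def dependency_graph_def dep_rel_def)
  then show ?case using Cons.IH k by (auto intro: relpow_Suc_I2 simp del: relpow.simps)
qed

text \<open>The bound on \<open>i\<close> matters for \<open>k = 0\<close>: \<open>R ^^ 0\<close>
  relates every number to itself, whereas an empty walk must start at a vertex of the graph.\<close>

lemma dep_rel_awalk:
  assumes "i < n" "(i, j) \<in> dep_rel n \<alpha> e ^^ k"
  shows "\<exists>p. pre_digraph.awalk (dependency_graph n \<alpha> e) (Var i) p (Var j) \<and> length p = k"
  using assms
proof (induction k arbitrary: i)
  case 0
  then show ?case
    by (auto simp: pre_digraph.awalk_def pre_digraph.cas.simps dependency_graph_def)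
next
  case (Suc k)
  obtain l where l: "(i, l) \<in> dep_rel n \<alpha> e" "(l, j) \<in> dep_rel n \<alpha> e ^^ k"
    using relpow_Suc_D2[OF Suc.prems(2)] by blast
  then have "l < n" by (simp add: dep_rel_def)
  then obtain p where "pre_digraph.awalk (dependency_graph n \<alpha> e) (Var l) p (Var j)" "length p = k"
    using Suc.IH l by blast
  then show ?case
    using l by (intro exI[of _ "(Var i, Var l) # p"])
      (auto simp: pre_digraph.awalk_def pre_digraph.cas.simps dependency_graph_def dep_rel_def)
qed

lemma awalk_iff_dep_rel:
  assumes "i < n"
  shows "(\<exists>p. pre_digraph.awalk (dependency_graph n \<alpha> e) (Var i) p (Var j) \<and> length p = k)
    \<longleftrightarrow> (i, j) \<in> dep_rel n \<alpha> e ^^ k"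
  using dep_rel_awalk[OF assms] awalk_dep_rel by blast

lemma vertex_loop_number_dependency_graph:
  assumes "i < n"
  shows "vertex_loop_number (dependency_graph n \<alpha> e) (Var i) = rel_loop_number (dep_rel n \<alpha> e) i"
proof -
  let ?W = "\<lambda>p. pre_digraph.awalk (dependency_graph n \<alpha> e) (Var i) p (Var i)"
  let ?R = "dep_rel n \<alpha> e"
  have "(\<exists>p. ?W p \<and> 0 < length p) = (\<exists>k>0. (i, i) \<in> ?R ^^ k)"
    by (simp flip: awalk_iff_dep_rel[OF assms]) blast
  moreover have "(\<exists>p q. ?W p \<and> ?W q \<and> int t = int (length p) - int (length q)) =
      (\<exists>k l. (i, i) \<in> ?R ^^ k \<and> (i, i) \<in> ?R ^^ l \<and> int t = int k - int l)" for t
    by (simp flip: awalk_iff_dep_rel[OF assms]) blast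
  ultimately show ?thesis by (simp only: vertex_loop_number_def rel_loop_number_def)
qed

lemma dep_strongly_connected_rtrancl:
  assumes "dep_strongly_connected (dependency_graph n \<alpha> e)" "i < n" "j < n"
  shows "(i, j) \<in> (dep_rel n \<alpha> e)\<^sup>*"
proof -
  obtain p where "pre_digraph.awalk (dependency_graph n \<alpha> e) (Var i) p (Var j)"
    using assms by (auto simp: dep_strongly_connected_def dependency_graph_def)
  then show ?thesis using awalk_dep_rel relpow_imp_rtrancl by blast
qed

text \<open>The vertex \<open>i\<close> keeps the quantifier under the \<open>THE\<close> from being
  vacuous, and strong connectivity makes the value common to all vertices.\<close>

lemma loop_number_dependency_graph:
  assumes "dep_strongly_connected (dependency_graph n \<alpha> e)" "i < n"
  shows "loop_number (dependency_graph n \<alpha> e) = rel_loop_number (dep_rel n \<alpha> e) i"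
proof -
  let ?X = "dependency_graph n \<alpha> e"
  have V: "verts ?X - {Eps} = Var ` {..<n}" by (auto simp: dependency_graph_def)
  have "vertex_loop_number ?X (Var j) = rel_loop_number (dep_rel n \<alpha> e) i" if "j < n" for j
    using that assms
    by (simp add: vertex_loop_number_dependency_graph)
      (blast intro: rel_loop_number_eq dep_strongly_connected_rtrancl)
  then show ?thesis
    unfolding loop_number_def V using assms(2) by (intro the_equality) auto
qed

section \<open>Iterates of a monomial map\<close>

lemma prod_bit_eq_1_iff:
  fixes g :: "'a \<Rightarrow> bit"
  assumes "finite A"
  shows "(\<Prod>a\<in>A. g a) = 1 \<longleftrightarrow> (\<forall>a\<in>A. g a = 1)"
proof -
  have "(\<Prod>a\<in>A. g a) = 0 \<longleftrightarrow> (\<exists>a\<in>A. g a = 0)" using assms by (simp add: prod_zero_iff)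
  then show ?thesis by (metis bit_not_zero_iff zero_neq_one)
qed

lemma monomial_map_cube: "monomial_map n \<alpha> e x \<in> cube n"
  by (auto simp: monomial_map_def cube_def)

text \<open>The edge to \<open>j'\<close> forces \<open>\<alpha> i = 1\<close>. For the zero
  monomial the right-hand side would hold vacuously.\<close>

lemma monomial_map_eq_1_iff:
  assumes "boolean_monomial_system n \<alpha> e" "(i, j') \<in> dep_rel n \<alpha> e"
  shows "monomial_map n \<alpha> e x i = 1 \<longleftrightarrow> (\<forall>j. (i, j) \<in> dep_rel n \<alpha> e \<longrightarrow> x j = 1)"
proof -
  have i: "i < n" "\<alpha> i = 1" using assms(2) by (auto simp: dep_rel_def)
  have e: "e j i = 0 \<or> e j i = 1" if "j < n" for j
    using assms(1) i that by (auto simp: boolean_monomial_system_def)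
  have "monomial_map n \<alpha> e x i = 1 \<longleftrightarrow> (\<forall>j<n. x j ^ e j i = 1)"
    using i by (simp add: monomial_map_def prod_bit_eq_1_iff Ball_def)
  also have "\<dots> \<longleftrightarrow> (\<forall>j<n. e j i = 1 \<longrightarrow> x j = 1)"
    using e by (metis power_0 power_one_right zero_neq_one)
  finally show ?thesis using i by (auto simp: dep_rel_def)
qed

lemma monomial_map_funpow_eq_1_iff:
  assumes sys: "boolean_monomial_system n \<alpha> e"
    and total: "\<And>i. i < n \<Longrightarrow> \<exists>j. (i, j) \<in> dep_rel n \<alpha> e"
    and i: "i < n"
  shows "(monomial_map n \<alpha> e ^^ k) x i = 1 \<longleftrightarrow> (\<forall>j. (i, j) \<in> dep_rel n \<alpha> e ^^ k \<longrightarrow> x j = 1)"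
  using i
proof (induction k arbitrary: i)
  case 0
  then show ?case by simp
next
  case (Suc k)
  obtain j' where j': "(i, j') \<in> dep_rel n \<alpha> e" using total Suc.prems by blast
  have "(monomial_map n \<alpha> e ^^ Suc k) x i = 1
      \<longleftrightarrow> (\<forall>l. (i, l) \<in> dep_rel n \<alpha> e \<longrightarrow> (monomial_map n \<alpha> e ^^ k) x l = 1)"
    using monomial_map_eq_1_iff[OF sys j'] by simp
  also have "\<dots> \<longleftrightarrow> (\<forall>l. (i, l) \<in> dep_rel n \<alpha> e \<longrightarrow>
      (\<forall>j. (l, j) \<in> dep_rel n \<alpha> e ^^ k \<longrightarrow> x j = 1))"
    using Suc.IH by (auto simp: dep_rel_def)
  also have "\<dots> \<longleftrightarrow> (\<forall>j. (i, j) \<in> dep_rel n \<alpha> e ^^ Suc k \<longrightarrow> x j = 1)"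
    \<comment> \<open>A walk of length \<open>Suc k\<close> is split after its first edge.\<close>
    by (meson relpow_Suc_D2 relpow_Suc_I2)
  finally show ?case .
qed

section \<open>Cycles in a state space\<close>

definition periodic_points :: "nat \<Rightarrow> ((nat \<Rightarrow> bit) \<Rightarrow> (nat \<Rightarrow> bit)) \<Rightarrow> (nat \<Rightarrow> bit) set" where
  "periodic_points n f = {u \<in> cube n. \<exists>k>0. (f ^^ k) u = u}"

text \<open>Records neither a starting point nor a period: all points of one periodic orbit give the
  same graph.\<close>

definition orbit_graph :: "('a \<Rightarrow> 'a) \<Rightarrow> 'a \<Rightarrow> ('a, 'a \<times> 'a) pre_digraph" where
  "orbit_graph f u =
     \<lparr>verts = range (\<lambda>i. (f ^^ i) u), arcs = (\<lambda>v. (v, f v)) ` range (\<lambda>i. (f ^^ i) u),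
      tail = fst, head = snd\<rparr>"

definition orbit_walk :: "('a \<Rightarrow> 'a) \<Rightarrow> 'a \<Rightarrow> nat \<Rightarrow> ('a \<times> 'a) list" where
  "orbit_walk f u m = map (\<lambda>i. ((f ^^ i) u, (f ^^ Suc i) u)) [0..<m]"

lemma length_orbit_walk [simp]: "length (orbit_walk f u m) = m"
  by (simp add: orbit_walk_def)

lemma orbit_walk_Suc: "orbit_walk f u (Suc m) = (u, f u) # orbit_walk f (f u) m"
proof -
  have "[0..<Suc m] = 0 # map Suc [0..<m]" by (metis map_Suc_upt upt_conv_Cons zero_less_Suc)
  then show ?thesis by (simp add: orbit_walk_def funpow_swap1)
qed

text \<open>Each state has exactly one outgoing arc, so start and length determine a walk.\<close>

lemma awalk_state_space:
  assumes "pre_digraph.awalk (state_space n f) u p v"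
  shows "p = orbit_walk f u (length p) \<and> v = (f ^^ length p) u"
  using assms
proof (induction p arbitrary: u)
  case Nil
  then show ?case by (simp add: pre_digraph.awalk_def pre_digraph.cas.simps orbit_walk_def)
next
  case (Cons a p)
  have "a = (u, f u)" "pre_digraph.awalk (state_space n f) (f u) p v"
    using Cons.prems by (auto simp: pre_digraph.awalk_def pre_digraph.cas.simps state_space_def)
  then show ?case using Cons.IH by (simp add: orbit_walk_Suc funpow_swap1)
qed

lemma awalk_orbit_walk:
  assumes "\<And>x. x \<in> cube n \<Longrightarrow> f x \<in> cube n" "u \<in> cube n"
  shows "pre_digraph.awalk (state_space n f) u (orbit_walk f u m) ((f ^^ m) u)"
  using assms(2)
proof (induction m arbitrary: u)
  case 0
  then show ?case
    by (simp add: pre_digraph.awalk_def pre_digraph.cas.simps orbit_walk_def state_space_def)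
next
  case (Suc m)
  then have "pre_digraph.awalk (state_space n f) (f u) (orbit_walk f (f u) m) ((f ^^ m) (f u))"
    using assms(1) by blast
  then show ?case using Suc.prems assms(1)
    by (auto simp: pre_digraph.awalk_def pre_digraph.cas.simps state_space_def orbit_walk_Suc
        funpow_swap1)
qed

section \<open>Periodic orbits and limit cycles\<close>

lemma funpow_periodic_mod:
  assumes "(f ^^ m) u = u"
  shows "(f ^^ (i mod m)) u = (f ^^ i) u"
proof -
  have "(f ^^ (k * m)) u = u" for k
    by (induction k) (simp_all add: funpow_add assms)
  then have "(f ^^ (i mod m + (i div m) * m)) u = (f ^^ (i mod m)) u"
    by (simp only: funpow_add o_apply)
  then show ?thesis by (simp only: mod_div_mult_eq)
qed

text \<open>The tails of the arcs of \<open>orbit_walk f u m\<close> are the iterates in the first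
  equation, the heads those in the second; \<open>cycle\<close> tests the heads for
  distinctness.\<close>

lemma periodic_orbit_eq:
  assumes "(f ^^ m) u = u" "0 < m"
  shows "(\<lambda>i. (f ^^ i) u) ` {..<m} = range (\<lambda>i. (f ^^ i) u)"
    and "(\<lambda>i. (f ^^ Suc i) u) ` {..<m} = range (\<lambda>i. (f ^^ i) u)"
proof -
  show 1: "(\<lambda>i. (f ^^ i) u) ` {..<m} = range (\<lambda>i. (f ^^ i) u)"
    using funpow_periodic_mod[OF assms(1)] assms(2)
    by (auto intro!: image_eqI[where x = "_ mod m"])
  have "(f ^^ i) u \<in> (\<lambda>i. (f ^^ Suc i) u) ` {..<m}" for i
  proof
    \<comment> \<open>Adding \<open>m\<close> lets the predecessor index be
      \<open>i + m - 1\<close>, without truncation at \<open>i = 0\<close>.\<close>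
    have "(f ^^ i) u = (f ^^ ((i + m) mod m)) u" using funpow_periodic_mod[OF assms(1)] by simp
    also have "\<dots> = (f ^^ (Suc ((i + m - 1) mod m) mod m)) u" using assms(2) by (simp add: mod_Suc_eq)
    also have "\<dots> = (f ^^ Suc ((i + m - 1) mod m)) u" by (rule funpow_periodic_mod[OF assms(1)])
    finally show "(f ^^ i) u = (f ^^ Suc ((i + m - 1) mod m)) u" .
  qed (use assms(2) in simp)
  then show "(\<lambda>i. (f ^^ Suc i) u) ` {..<m} = range (\<lambda>i. (f ^^ i) u)"
    by (auto simp del: funpow.simps)
qed

lemma cycle_graph_orbit_walk:
  assumes "(f ^^ m) u = u" "0 < m"
  shows "cycle_graph (state_space n f) (orbit_walk f u m) = orbit_graph f u"
proof -
  have "set (orbit_walk f u m) = (\<lambda>v. (v, f v)) ` (\<lambda>i. (f ^^ i) u) ` {..<m}"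
    by (auto simp: orbit_walk_def)
  also have "\<dots> = (\<lambda>v. (v, f v)) ` range (\<lambda>i. (f ^^ i) u)"
    by (simp only: periodic_orbit_eq(1)[OF assms])
  finally have s: "set (orbit_walk f u m) = (\<lambda>v. (v, f v)) ` range (\<lambda>i. (f ^^ i) u)" .
  show ?thesis
    by (simp add: cycle_graph_def orbit_graph_def s state_space_def image_image)
qed

lemma cycle_state_space_iff:
  assumes "\<And>x. x \<in> cube n \<Longrightarrow> f x \<in> cube n"
  shows "pre_digraph.cycle (state_space n f) p \<longleftrightarrow>
    (\<exists>u m. u \<in> cube n \<and> 0 < m \<and> (f ^^ m) u = u \<and> p = orbit_walk f u m \<and>
           inj_on (\<lambda>i. (f ^^ Suc i) u) {..<m})" (is "?L \<longleftrightarrow> ?R")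
proof -
  let ?G = "state_space n f"
  have d: "distinct (tl (pre_digraph.awalk_verts ?G u (orbit_walk f u m)))
      \<longleftrightarrow> inj_on (\<lambda>i. (f ^^ Suc i) u) {..<m}"
    if "u \<in> cube n" "0 < m" for u m
  proof -
    have "pre_digraph.cas ?G u (orbit_walk f u m) ((f ^^ m) u)"
      using awalk_orbit_walk[of n f, OF assms that(1)] by (simp add: pre_digraph.awalk_def)
    moreover have "orbit_walk f u m \<noteq> []" using that by (simp add: orbit_walk_def)
    ultimately have "tl (pre_digraph.awalk_verts ?G u (orbit_walk f u m)) = map snd (orbit_walk f u m)"
      by (simp add: pre_digraph.awalk_verts_conv' state_space_def)
    then show ?thesis
      by (simp add: orbit_walk_def distinct_map o_def lessThan_atLeast0 del: funpow.simps)
  qed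
  show ?thesis
  proof
    assume ?L
    then obtain u where u: "pre_digraph.awalk ?G u p u" "p \<noteq> []"
        "distinct (tl (pre_digraph.awalk_verts ?G u p))"
      by (auto simp: pre_digraph.cycle_def)
    then have "u \<in> cube n" by (simp add: pre_digraph.awalk_def state_space_def)
    moreover have "p = orbit_walk f u (length p)" "(f ^^ length p) u = u"
      using awalk_state_space[OF u(1)] by auto
    ultimately show ?R using u d[of u "length p"] by (metis length_greater_0_conv)
  next
    assume ?R
    then obtain u m where um: "u \<in> cube n" "0 < m" "(f ^^ m) u = u" "p = orbit_walk f u m"
      "inj_on (\<lambda>i. (f ^^ Suc i) u) {..<m}" by blast
    then have "pre_digraph.awalk ?G u p u" using awalk_orbit_walk[of n f, OF assms um(1), of m] by simp
    moreover have "p \<noteq> []" using um by (simp add: orbit_walk_def)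
    ultimately show ?L unfolding pre_digraph.cycle_def using d[OF um(1,2)] um by blast
  qed
qed

text \<open>For the least period \<open>m\<close>, equal iterates with \<open>i < j < m\<close>
  would, after \<open>m - Suc i\<close> further applications, make \<open>j - i\<close> a smaller
  period.\<close>

lemma periodic_point_minimal_period:
  assumes "0 < k" "(f ^^ k) u = u"
  obtains m where "0 < m" "(f ^^ m) u = u" "inj_on (\<lambda>i. (f ^^ Suc i) u) {..<m}"
proof -
  define m where "m = (LEAST k. 0 < k \<and> (f ^^ k) u = u)"
  have m: "0 < m \<and> (f ^^ m) u = u"
    unfolding m_def by (rule LeastI[of _ k]) (use assms in simp)
  have min: "m \<le> k" if "0 < k" "(f ^^ k) u = u" for k
    unfolding m_def by (rule Least_le) (use that in simp)
  have "False" if ij: "i < j" "j < m" "(f ^^ Suc i) u = (f ^^ Suc j) u" for i j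
  proof -
    have "(f ^^ (m - Suc i)) ((f ^^ Suc i) u) = (f ^^ (m - Suc i)) ((f ^^ Suc j) u)"
      by (simp only: ij)
    then have "(f ^^ (m - Suc i + Suc i)) u = (f ^^ (m - Suc i + Suc j)) u"
      by (simp only: funpow_add o_apply)
    moreover have "m - Suc i + Suc i = m" "m - Suc i + Suc j = (j - i) + m" using ij by auto
    ultimately have "(f ^^ m) u = (f ^^ ((j - i) + m)) u" by (simp only:)
    then have "(f ^^ (j - i)) u = u" using m by (simp add: funpow_add)
    then show False using min[of "j - i"] ij by simp
  qed
  then have "inj_on (\<lambda>i. (f ^^ Suc i) u) {..<m}"
    unfolding inj_on_def by (metis lessThan_iff linorder_neqE_nat)
  then show thesis using m that by blast
qed

text \<open>A periodic point may come with any period, but a cycle has distinct heads. Passing to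
  the minimal period leaves \<open>orbit_graph f u\<close> unchanged.\<close>

lemma limit_cycles_state_space:
  assumes "\<And>x. x \<in> cube n \<Longrightarrow> f x \<in> cube n"
  shows "limit_cycles (state_space n f) = orbit_graph f ` periodic_points n f"
proof (intro equalityI subsetI)
  fix C assume "C \<in> limit_cycles (state_space n f)"
  then obtain u m where "u \<in> cube n" "0 < m" "(f ^^ m) u = u"
      "C = cycle_graph (state_space n f) (orbit_walk f u m)"
    by (auto simp: limit_cycles_def cycle_state_space_iff[of n f, OF assms])
  then show "C \<in> orbit_graph f ` periodic_points n f"
    by (auto simp: cycle_graph_orbit_walk periodic_points_def)
next
  fix C assume "C \<in> orbit_graph f ` periodic_points n f"
  then obtain u k where u: "u \<in> cube n" "0 < k" "(f ^^ k) u = u" "C = orbit_graph f u"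
    by (auto simp: periodic_points_def)
  obtain m where m: "0 < m" "(f ^^ m) u = u" "inj_on (\<lambda>i. (f ^^ Suc i) u) {..<m}"
    using periodic_point_minimal_period[OF u(2,3)] by blast
  have "pre_digraph.cycle (state_space n f) (orbit_walk f u m)"
    using u m cycle_state_space_iff[of n f, OF assms] by blast
  then show "C \<in> limit_cycles (state_space n f)"
    using cycle_graph_orbit_walk[OF m(2,1), of n] u(4) unfolding limit_cycles_def by force
qed

lemma length_cycle_state_space:
  assumes "\<And>x. x \<in> cube n \<Longrightarrow> f x \<in> cube n" "pre_digraph.cycle (state_space n f) p"
  shows "length p = card (verts (cycle_graph (state_space n f) p))"
proof -
  obtain u m where um: "0 < m" "(f ^^ m) u = u" "p = orbit_walk f u m"
      "inj_on (\<lambda>i. (f ^^ Suc i) u) {..<m}"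
    using assms cycle_state_space_iff by blast
  have "verts (cycle_graph (state_space n f) p) = (\<lambda>i. (f ^^ Suc i) u) ` {..<m}"
    using um by (simp add: cycle_graph_orbit_walk periodic_orbit_eq(2) orbit_graph_def
        del: funpow.simps)
  then show ?thesis using card_image[OF um(4)] um by simp
qed

lemma funpow_periodic_points:
  assumes "\<And>x. x \<in> cube n \<Longrightarrow> f x \<in> cube n" "u \<in> periodic_points n f"
  shows "(f ^^ i) u \<in> periodic_points n f"
proof -
  obtain k where k: "u \<in> cube n" "0 < k" "(f ^^ k) u = u"
    using assms(2) by (auto simp: periodic_points_def)
  have "(f ^^ i) u \<in> cube n" using k assms(1) by (induction i) auto
  moreover have "(f ^^ k) ((f ^^ i) u) = (f ^^ i) u"
    using k by (metis add.commute funpow_add o_apply)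
  ultimately show ?thesis using k by (auto simp: periodic_points_def)
qed

lemma cycles_subgraph_state_space:
  assumes "\<And>x. x \<in> cube n \<Longrightarrow> f x \<in> cube n"
  shows "cycles_subgraph (state_space n f) =
    \<lparr>verts = periodic_points n f, arcs = (\<lambda>v. (v, f v)) ` periodic_points n f,
     tail = fst, head = snd\<rparr>"
proof -
  have "(\<Union>u\<in>periodic_points n f. range (\<lambda>i. (f ^^ i) u)) = periodic_points n f"
    using funpow_periodic_points[of n f, OF assms]
    by (auto intro!: rev_bexI range_eqI[of _ _ 0])
  moreover from this
  have "(\<Union>u\<in>periodic_points n f. (\<lambda>v. (v, f v)) ` range (\<lambda>i. (f ^^ i) u))
      = (\<lambda>v. (v, f v)) ` periodic_points n f"
    by (simp only: image_UN[symmetric])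
  moreover have "tail (state_space n f) = fst" "head (state_space n f) = snd"
    by (simp_all add: state_space_def)
  ultimately show ?thesis
    by (simp add: cycles_subgraph_def limit_cycles_state_space[of n f, OF assms] orbit_graph_def)
qed

section \<open>The polygon\<close>

lemma tgon_map_cube: "tgon_map t y \<in> cube t"
  by (auto simp: tgon_map_def cube_def)

lemma tgon_map_funpow:
  assumes "y \<in> cube t"
  shows "(tgon_map t ^^ k) y \<in> cube t"
    and "l < t \<Longrightarrow> (tgon_map t ^^ k) y l = y ((l + k) mod t)"
proof -
  show "(tgon_map t ^^ k) y \<in> cube t" using assms tgon_map_cube by (cases k) auto
  show "(tgon_map t ^^ k) y l = y ((l + k) mod t)" if "l < t"
    using that
  proof (induction k arbitrary: l)
    case (Suc k)
    have "Suc l mod t < t" using Suc.prems by simp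
    then show ?case using Suc
      by (simp add: tgon_map_def mod_add_left_eq)
  qed simp
qed

text \<open>The group element \<open>g\<close> shifts coordinates against \<open>tgon_map\<close>,
  so it acts as the \<open>k\<close>-th iterate when \<open>g + k\<close> is divisible by
  \<open>t\<close>. Negation permutes the residues, hence the orbits agree.\<close>

lemma orbit_cyclic_action:
  assumes t: "1 \<le> t" and y: "y \<in> cube t"
  shows "orbit (integer_mod_group t) (cyclic_action t) y = range (\<lambda>k. (tgon_map t ^^ k) y)"
proof -
  have eq: "cyclic_action t g y = (tgon_map t ^^ k) y" if "(g + int k) mod int t = 0" for g k
  proof
    fix l
    show "cyclic_action t g y l = (tgon_map t ^^ k) y l"
    proof (cases "l < t")
      case True
      have "int t dvd (int l + int k) - (int l - g)" using that by (simp add: dvd_eq_mod_eq_0 add.commute)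
      then have "(int l - g) mod int t = int ((l + k) mod t)"
        by (simp only: mod_eq_dvd_iff[symmetric] of_nat_mod of_nat_add)
      then show ?thesis using True y by (simp add: cyclic_action_apply tgon_map_funpow)
    next
      case False
      then show ?thesis using cyclic_action_closed[OF y, of g] tgon_map_funpow(1)[OF y, of k]
        by (auto simp: cube_def PiE_def extensional_def)
    qed
  qed
  show ?thesis
  proof (intro equalityI subsetI)
    fix x assume "x \<in> orbit (integer_mod_group t) (cyclic_action t) y"
    then obtain g where g: "x = cyclic_action t g y"
      by (auto simp: orbit_def)
    have "(g + int (nat ((- g) mod int t))) mod int t = 0"
      using t by (simp add: mod_add_right_eq)
    then show "x \<in> range (\<lambda>k. (tgon_map t ^^ k) y)" unfolding g by (simp only: eq) (rule rangeI)
  next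
    fix x assume "x \<in> range (\<lambda>k. (tgon_map t ^^ k) y)"
    then obtain k where k: "x = (tgon_map t ^^ k) y" by blast
    have "((- int k) mod int t + int k) mod int t = 0" by (simp add: mod_add_left_eq)
    then have "x = cyclic_action t ((- int k) mod int t) y" using eq k by simp
    moreover have "(- int k) mod int t \<in> carrier (integer_mod_group t)"
      using t by (simp add: carrier_integer_mod_group)
    ultimately show "x \<in> orbit (integer_mod_group t) (cyclic_action t) y"
      by (auto simp: orbit_def)
  qed
qed

section \<open>Transfer along a conjugacy with the polygon\<close>

text \<open>Both digraphs are graphs of self-maps, so a bijection commuting with the maps acts on
  arcs by \<open>map_prod g g\<close> and carries orbits to orbits.\<close>

lemma conjugate_to_tgon:
  assumes f: "\<And>x. x \<in> cube n \<Longrightarrow> f x \<in> cube n" and t: "1 \<le> t"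
    and bij: "bij_betw g (periodic_points n f) (cube t)"
    and conj: "\<And>u. u \<in> periodic_points n f \<Longrightarrow> g (f u) = tgon_map t (g u)"
  shows "\<exists>h. pre_digraph.digraph_isomorphism (cycles_subgraph (state_space n f)) h \<and>
         app_iso h (cycles_subgraph (state_space n f)) = state_space t (tgon_map t) \<and>
         bij_betw (\<lambda>C. iso_verts h ` verts C)
           (limit_cycles (state_space n f))
           (orbits (integer_mod_group t) (cube t) (cyclic_action t)) \<and>
         (\<forall>p. pre_digraph.cycle (state_space n f) p \<longrightarrow>
              length p = card (iso_verts h ` verts (cycle_graph (state_space n f) p)))"
proof -
  let ?P = "periodic_points n f" and ?G = "state_space n f"
  \<comment> \<open>\<open>app_iso\<close> takes the head and tail maps of the image from the
    isomorphism, so they must be the projections used in \<open>state_space\<close>.\<close>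
  define h :: "(nat \<Rightarrow> bit, (nat \<Rightarrow> bit) \<times> (nat \<Rightarrow> bit), nat \<Rightarrow> bit, (nat \<Rightarrow> bit) \<times> (nat \<Rightarrow> bit))
      digraph_isomorphism"
    where "h = \<lparr>iso_verts = g, iso_arcs = map_prod g g, iso_head = snd, iso_tail = fst\<rparr>"
  have sub: "cycles_subgraph ?G = \<lparr>verts = ?P, arcs = (\<lambda>v. (v, f v)) ` ?P, tail = fst, head = snd\<rparr>"
    by (rule cycles_subgraph_state_space[of n f, OF f])
  have limit: "limit_cycles ?G = orbit_graph f ` ?P"
    by (rule limit_cycles_state_space) (rule f)
  have inj: "inj_on g ?P" and im: "g ` ?P = cube t" using bij by (auto simp: bij_betw_def)
  have fP: "(f ^^ i) u \<in> ?P" if "u \<in> ?P" for u i by (rule funpow_periodic_points[of n f, OF f that])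
  have gi: "g ((f ^^ i) u) = (tgon_map t ^^ i) (g u)" if "u \<in> ?P" for u i
    by (induction i) (simp_all add: conj fP[OF that])
  have verts_sub: "verts (orbit_graph f u) \<subseteq> ?P" if "u \<in> ?P" for u
    using fP[OF that] by (auto simp: orbit_graph_def)
  have orb: "g ` verts (orbit_graph f u) = orbit (integer_mod_group t) (cyclic_action t) (g u)"
    if "u \<in> ?P" for u
  proof -
    have "g u \<in> cube t" using im that by blast
    then show ?thesis
      using that by (simp add: orbit_cyclic_action[OF t] orbit_graph_def image_image gi)
  qed
  have "wf_digraph (cycles_subgraph ?G)"
    unfolding sub by standard (use fP[of _ 1] in auto)
  then have 1: "pre_digraph.digraph_isomorphism (cycles_subgraph ?G) h"
    unfolding pre_digraph.digraph_isomorphism_def h_def sub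
    using inj by (auto simp: inj_on_def)
  have "map_prod g g ` (\<lambda>v. (v, f v)) ` ?P = (\<lambda>y. (y, tgon_map t y)) ` g ` ?P"
    by (auto simp: image_image conj)
  also have "\<dots> = {(u, v). u \<in> cube t \<and> v \<in> cube t \<and> tgon_map t u = v}"
    unfolding im using tgon_map_cube by auto
  finally have 2: "app_iso h (cycles_subgraph ?G) = state_space t (tgon_map t)"
    unfolding app_iso_def sub h_def by (simp add: state_space_def im)
  have 3: "bij_betw (\<lambda>C. g ` verts C) (limit_cycles ?G)
           (orbits (integer_mod_group t) (cube t) (cyclic_action t))"
    unfolding limit
  proof (rule bij_betw_imageI)
    show "inj_on (\<lambda>C. g ` verts C) (orbit_graph f ` ?P)"
    proof (rule inj_onI)
      fix C D assume C: "C \<in> orbit_graph f ` ?P" and D: "D \<in> orbit_graph f ` ?P"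
        and "g ` verts C = g ` verts D"
      then have "verts C = verts D"
        using verts_sub by (auto simp: inj_on_image_eq_iff[OF inj])
      \<comment> \<open>A limit cycle is determined by its vertices, since its arcs are the graph of
        \<open>f\<close> on them.\<close>
      moreover have "arcs X = (\<lambda>v. (v, f v)) ` verts X \<and> tail X = fst \<and> head X = snd"
        if "X \<in> orbit_graph f ` ?P" for X
        using that by (auto simp: orbit_graph_def)
      ultimately show "C = D" using C D by (intro pre_digraph.equality) simp_all
    qed
    have "orbits (integer_mod_group t) (cube t) (cyclic_action t)
        = orbit (integer_mod_group t) (cyclic_action t) ` g ` ?P"
      unfolding im by (auto simp: orbits_def)
    then show "(\<lambda>C. g ` verts C) ` orbit_graph f ` ?P
        = orbits (integer_mod_group t) (cube t) (cyclic_action t)"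
      by (simp add: image_image orb cong: image_cong_simp)
  qed
  have 4: "length p = card (g ` verts (cycle_graph ?G p))" if p: "pre_digraph.cycle ?G p" for p
  proof -
    have "cycle_graph ?G p \<in> limit_cycles ?G" using p by (auto simp: limit_cycles_def)
    then obtain u where "u \<in> ?P" "cycle_graph ?G p = orbit_graph f u"
      unfolding limit by blast
    then have "verts (cycle_graph ?G p) \<subseteq> ?P" using verts_sub by metis
    then show ?thesis
      using length_cycle_state_space[of n f, OF f p] card_image[OF inj_on_subset[OF inj]] by metis
  qed
  show ?thesis
    by (rule exI[of _ h]) (use 1 2 3 4 in \<open>simp add: h_def\<close>)
qed

section \<open>Periodic points of a monomial system\<close>

lemma periodic_points_monomial:
  assumes sys: "boolean_monomial_system n \<alpha> e"
    and f: "f = monomial_map n \<alpha> e"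
    and total: "\<And>i. i < n \<Longrightarrow> \<exists>j. (i, j) \<in> dep_rel n \<alpha> e"
    and t: "1 \<le> t"
    and c: "c ` {..<n} = {..<t}"
    and edge: "\<And>i j. (i, j) \<in> dep_rel n \<alpha> e \<Longrightarrow> c j = Suc (c i) mod t"
    and walk: "\<And>i j k. i < n \<Longrightarrow> j < n \<Longrightarrow> K \<le> k \<Longrightarrow> (c i + k) mod t = c j
        \<Longrightarrow> (i, j) \<in> dep_rel n \<alpha> e ^^ k"
  shows "\<exists>g. bij_betw g (periodic_points n f) (cube t) \<and>
           (\<forall>u\<in>periodic_points n f. g (f u) = tgon_map t (g u))"
proof -
  let ?R = "dep_rel n \<alpha> e" and ?P = "periodic_points n f"
  \<comment> \<open>Pullback along the classes; the required \<open>g\<close> will be its inverse on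
    the periodic points.\<close>
  define E where "E y = (\<lambda>i\<in>{..<n}. y (c i))" for y :: "nat \<Rightarrow> bit"
  have ct: "c i < t" if "i < n" for i using c that by auto
  have E_cube: "E y \<in> cube n" for y by (simp add: E_def cube_def)
  have bit_eq: "a = b" if "a = 1 \<longleftrightarrow> b = 1" for a b :: bit
    using that by (cases a; cases b) auto
  have fE: "f (E y) = E (tgon_map t y)" for y
  proof
    fix i
    show "f (E y) i = E (tgon_map t y) i"
    proof (cases "i < n")
      case True
      obtain j' where j': "(i, j') \<in> ?R" using total True by blast
      \<comment> \<open>All successors of \<open>i\<close> lie in one class, so the product over
        them collapses to a single bit; \<open>j'\<close> guarantees a successor.\<close>
      have R: "E y j = y (Suc (c i) mod t)" if "(i, j) \<in> ?R" for j
        using that edge[OF that] by (simp add: E_def dep_rel_def)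
      have "f (E y) i = 1 \<longleftrightarrow> (\<forall>j. (i, j) \<in> ?R \<longrightarrow> E y j = 1)"
        unfolding f by (rule monomial_map_eq_1_iff[OF sys j'])
      also have "\<dots> \<longleftrightarrow> y (Suc (c i) mod t) = 1" using R j' by metis
      also have "\<dots> \<longleftrightarrow> E (tgon_map t y) i = 1" using True ct by (simp add: E_def tgon_map_def)
      finally show ?thesis by (rule bit_eq)
    qed (simp add: f E_def monomial_map_def)
  qed
  have fEk: "(f ^^ k) (E y) = E ((tgon_map t ^^ k) y)" for k y
    by (induction k) (simp_all add: fE)
  have "(tgon_map t ^^ t) y = y" if "y \<in> cube t" for y
    by (rule extensionalityI[of _ "{..<t}"])
      (use that tgon_map_funpow(1)[OF that, of t] tgon_map_funpow(2)[OF that, of _ t]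
        in \<open>auto simp: cube_def PiE_def\<close>)
  then have E_per: "E y \<in> ?P" if "y \<in> cube t" for y
    using that t fEk[of t y] E_cube by (auto simp: periodic_points_def intro!: exI[of _ t])
  have inj: "inj_on E (cube t)"
  proof (rule inj_onI)
    fix y z assume yz: "y \<in> cube t" "z \<in> cube t" "E y = E z"
    show "y = z"
    proof (rule extensionalityI[of _ "{..<t}"])
      fix l assume "l \<in> {..<t}"
      then obtain i where "i < n" "c i = l" using c by (metis imageE lessThan_iff)
      then show "y l = z l" using fun_cong[OF yz(3), of i] by (simp add: E_def)
    qed (use yz in \<open>auto simp: cube_def PiE_def\<close>)
  qed
  have surj: "x \<in> E ` cube t" if x: "x \<in> ?P" for x
  proof -
    obtain m where xm: "x \<in> cube n" "0 < m" "(f ^^ m) x = x" using x by (auto simp: periodic_points_def)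
    \<comment> \<open>A multiple of the period \<open>m\<close>, so that \<open>x\<close> is fixed;
      a multiple of \<open>t\<close>, so that classes are preserved; and at least \<open>K\<close>,
      so that any two vertices of a class are joined by a walk of length \<open>k\<close>.\<close>
    define k where "k = m * (K * t)"
    have k: "K \<le> k" "k mod t = 0" using xm(2) t by (auto simp: k_def)
    have fk: "(f ^^ k) x = x"
      using funpow_periodic_mod[OF xm(3), of k] by (simp add: k_def)
    \<comment> \<open>Since \<open>x j\<close> is also the \<open>j\<close>-th bit after
      \<open>k\<close> steps, the value 1 spreads to every vertex reached from \<open>j\<close> by a
      walk of length \<open>k\<close>. Exchanging \<open>i\<close> and \<open>j\<close> gives
      equality.\<close>
    have "x i = 1" if ij: "i < n" "j < n" "c i = c j" "x j = 1" for i j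
    proof -
      have "\<forall>l. (j, l) \<in> ?R ^^ k \<longrightarrow> x l = 1"
        using monomial_map_funpow_eq_1_iff[OF sys total ij(2), of k x] fk ij(4) by (simp add: f)
      moreover have "(j, i) \<in> ?R ^^ k"
        using walk[OF ij(2,1) k(1)] ij k(2) ct[OF ij(1)] by (simp add: mod_add_right_eq[symmetric, of _ k])
      ultimately show ?thesis by blast
    qed
    then have const: "x i = x j" if "i < n" "j < n" "c i = c j" for i j
      using that by (metis bit_eq)
    define y where "y = (\<lambda>l\<in>{..<t}. x (SOME i. i < n \<and> c i = l))"
    have "E y = x"
    proof (rule extensionalityI[of _ "{..<n}"])
      fix i assume "i \<in> {..<n}"
      then have i: "i < n" by simp
      let ?j = "SOME j. j < n \<and> c j = c i"
      have "?j < n \<and> c ?j = c i" by (rule someI[of _ i]) (use i in simp)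
      then show "E y i = x i" using i ct const[of ?j i] by (simp add: E_def y_def)
    qed (use xm in \<open>auto simp: E_def cube_def PiE_def\<close>)
    moreover have "y \<in> cube t" by (simp add: y_def cube_def)
    ultimately show ?thesis by blast
  qed
  have bij: "bij_betw E (cube t) ?P"
    unfolding bij_betw_def using inj surj E_per by auto
  define g where "g = inv_into (cube t) E"
  have "g (f u) = tgon_map t (g u)" if u: "u \<in> ?P" for u
  proof -
    obtain y where y: "y \<in> cube t" "u = E y" using surj[OF u] by blast
    then show ?thesis using inj tgon_map_cube[of t y] by (simp add: g_def fE)
  qed
  then show ?thesis using bij_betw_inv_into[OF bij] unfolding g_def by blast
qed

theorem corollary4p11:
  fixes n t :: nat and \<alpha> :: "nat \<Rightarrow> bit" and e :: "nat \<Rightarrow> nat \<Rightarrow> nat"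
    and f :: "(nat \<Rightarrow> bit) \<Rightarrow> (nat \<Rightarrow> bit)"
  assumes "1 \<le> n"
    and "boolean_monomial_system n \<alpha> e"
    and "f = monomial_map n \<alpha> e"
    and "dep_strongly_connected (dependency_graph n \<alpha> e)"
    and "loop_number (dependency_graph n \<alpha> e) = t"
    and "1 \<le> t"
  shows "digraph_iso (cycles_subgraph (state_space n f)) (state_space t (tgon_map t)) \<and>
    (\<exists>h. pre_digraph.digraph_isomorphism (cycles_subgraph (state_space n f)) h \<and>
         app_iso h (cycles_subgraph (state_space n f)) = state_space t (tgon_map t) \<and>
         bij_betw (\<lambda>C. iso_verts h ` verts C)
           (limit_cycles (state_space n f))
           (orbits (integer_mod_group t) (cube t) (cyclic_action t)) \<and>
         (\<forall>p. pre_digraph.cycle (state_space n f) p \<longrightarrow>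
              length p = card (iso_verts h ` verts (cycle_graph (state_space n f) p))))"
proof -
  let ?R = "dep_rel n \<alpha> e"
  have strong: "(i, j) \<in> ?R\<^sup>*" if "i < n" "j < n" for i j
    using dep_strongly_connected_rtrancl[OF assms(4)] that by blast
  have loop: "rel_loop_number ?R i = t" if "i < n" for i
    using loop_number_dependency_graph[OF assms(4) that] assms(5) by simp
  \<comment> \<open>A positive loop number provides a closed walk of positive length at
    \<open>i\<close>, whose first edge is the one sought. Thus no coordinate of \<open>f\<close> is
    constant.\<close>
  have total: "\<exists>j. (i, j) \<in> ?R" if i: "i < n" for i
  proof -
    obtain k where "0 < k" "(i, i) \<in> ?R ^^ k"
      using loop[OF i] assms(6) by (auto simp: rel_loop_number_def split: if_splits)
    then show ?thesis by (metis gr0_implies_Suc relpow_Suc_D2)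
  qed
  obtain c K where c: "c ` {..<n} = {..<t}"
    "\<And>i j. (i, j) \<in> ?R \<Longrightarrow> c j = Suc (c i) mod t"
    "\<And>i j k. i < n \<Longrightarrow> j < n \<Longrightarrow> K \<le> k \<Longrightarrow> (c i + k) mod t = c j \<Longrightarrow> (i, j) \<in> ?R ^^ k"
  \<comment> \<open>Vertex \<open>0\<close>, present because \<open>1 \<le> n\<close>, is the base
    point of the classes.\<close>
  proof (rule cyclic_classes[of "{..<n}" 0 ?R t])
    show "?R \<subseteq> {..<n} \<times> {..<n}" by (auto simp: dep_rel_def)
  qed (use assms(1,6) strong total loop[of 0] that in auto)
  obtain g where g: "bij_betw g (periodic_points n f) (cube t)"
    "\<And>u. u \<in> periodic_points n f \<Longrightarrow> g (f u) = tgon_map t (g u)"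
    using periodic_points_monomial[OF assms(2,3) total assms(6) c] by blast
  have "f x \<in> cube n" for x using assms(3) monomial_map_cube by simp
  then show ?thesis
    using conjugate_to_tgon[OF _ assms(6) g] unfolding digraph_iso_def by metis
qed

end
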